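(* There exist sets $S_i\subset\mathbb{N}$ $(i\ge1)$ such that the set $$K=\{0\}\cup\bigcup_{i=1}^\infty2^{-i}(1+A_{S_i})\subset\mathbb{R}$$ is compact and $\dim_H^D K<\dim_U K$ for all $D\in\mathcal{D}$.
   Context: $\mathbb{N}$ is the set of positive integers and $|E|$ denotes the diameter of a set $E$. For $S\subset\mathbb{N}$, $A_S=\left\{\sum_{i\in S}x_i2^{-i}: x_i\in\{0,1\}\right\}$. For $X\subset\mathbb{R}$ and $a\in\mathbb{R}$, $aX=\{ax:x\in X\}$ and $a+X=\{a+x:x\in X\}$. $\mathcal{D}$ is the family of all sets $D\subset(0,\infty)$ with $\inf D=0$ that are open in the Sorgenfrey topology (generated by the intervals $[a,b)$), i.e. for every $t\in D$ there is $\delta>0$ with $[t,t+\delta)\subset D$. For $D\in\mathcal{D}$, $E\subset\mathbb{R}^n$ and $s\ge0$ let $$\mathcal{H}^s_{D,\infty}(E)=\inf\left\{\sum_{i=1}^\infty|E_i|^s: E\subset\bigcup_{i=1}^\infty E_i,\ |E_i|\in D\text{ for all }i\right\},\qquad \dim_H^D E=\inf\{s\ge0:\mathcal{H}^s_{D,\infty}(E)=0\}.$$ The universal restricted Hausdorff dimension is $\dim_U E=\sup\{\dim_H^D E: D\in\mathcal{D}\}$. *)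

theory Defs
  imports "HOL-Analysis.Analysis"
begin

definition sorgenfrey :: "real topology" where
  "sorgenfrey = topology_generated_by {{a..<b} | a b. a < b}"

lemma openin_sorgenfrey_iff:
  "openin sorgenfrey D \<longleftrightarrow> (\<forall>t\<in>D. \<exists>\<delta>>0. {t..<t + \<delta>} \<subseteq> D)"
proof
  assume "openin sorgenfrey D"
  then have "generate_topology_on {{a..<b} | a b. a < b} D"
    by (simp add: sorgenfrey_def openin_topology_generated_by_iff)
  then show "\<forall>t\<in>D. \<exists>\<delta>>0. {t..<t + \<delta>} \<subseteq> D"
  proof induction
    case Empty
    then show ?case by simp
  next
    case (Int U V)
    show ?case
    proof
      fix t assume "t \<in> U \<inter> V"
      with Int.IH obtain d e where "d > 0" "{t..<t + d} \<subseteq> U" "e > 0" "{t..<t + e} \<subseteq> V"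
        by (meson IntD1 IntD2)
      then have "min d e > 0 \<and> {t..<t + min d e} \<subseteq> U \<inter> V"
        by (auto simp: subset_iff)
      then show "\<exists>\<delta>>0. {t..<t + \<delta>} \<subseteq> U \<inter> V" by blast
    qed
  next
    case (UN \<U>)
    then show ?case by (meson UnionE Union_upper subset_trans)
  next
    case (Basis U)
    then obtain a b where U: "U = {a..<b}" by blast
    show ?case
    proof
      fix t assume "t \<in> U"
      with U have "b - t > 0 \<and> {t..<t + (b - t)} \<subseteq> U" by auto
      then show "\<exists>\<delta>>0. {t..<t + \<delta>} \<subseteq> U" by blast
    qed
  qed
next
  assume D: "\<forall>t\<in>D. \<exists>\<delta>>0. {t..<t + \<delta>} \<subseteq> D"
  have "\<exists>U. openin sorgenfrey U \<and> t \<in> U \<and> U \<subseteq> D" if "t \<in> D" for t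
  proof -
    from D that obtain d where d: "d > 0" "{t..<t + d} \<subseteq> D" by blast
    have "openin sorgenfrey {t..<t + d}"
      unfolding sorgenfrey_def using d(1) by (intro topology_generated_by_Basis) force
    then show ?thesis using d by (intro exI[of _ "{t..<t + d}"]) auto
  qed
  then show "openin sorgenfrey D" by (subst openin_subopen) blast
qed

text \<open>Nonemptiness is part of \<open>inf D = 0\<close> (the infimum of the empty set is infinite), but
  the library leaves the real number \<open>Inf {}\<close> unspecified.\<close>

definition admissible_diameters :: "real set set" where
  "admissible_diameters =
    {D. D \<subseteq> {0<..} \<and> D \<noteq> {} \<and> Inf D = 0 \<and> openin sorgenfrey D}"

text \<open>The library's \<open>diameter\<close> is meaningful only for bounded sets; an unbounded set has infinite
  diameter, which never belongs to \<open>D\<close>, hence the explicit boundedness condition.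
  The infimum is taken in \<open>[0, \<infinity>]\<close>.\<close>

definition restricted_hausdorff_content ::
    "real set \<Rightarrow> real \<Rightarrow> 'a::euclidean_space set \<Rightarrow> ennreal" where
  "restricted_hausdorff_content D s E =
    Inf {(\<Sum>i. ennreal (diameter (C i) powr s)) | C :: nat \<Rightarrow> 'a set.
      E \<subseteq> (\<Union>i. C i) \<and> (\<forall>i. bounded (C i) \<and> diameter (C i) \<in> D)}"

definition restricted_hausdorff_dim :: "real set \<Rightarrow> 'a::euclidean_space set \<Rightarrow> ennreal" where
  "restricted_hausdorff_dim D E =
    Inf {ennreal s | s. 0 \<le> s \<and> restricted_hausdorff_content D s E = 0}"

definition universal_hausdorff_dim :: "'a::euclidean_space set \<Rightarrow> ennreal" where
  "universal_hausdorff_dim E =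
    (SUP D\<in>admissible_diameters. restricted_hausdorff_dim D E)"

text \<open>The sum over a possibly infinite set \<open>S\<close> of indices converges absolutely, so \<open>infsum\<close> does not
  fall back to its default value \<open>0\<close>.\<close>

definition binary_digit_set :: "nat set \<Rightarrow> real set" where
  "binary_digit_set S = {(\<Sum>\<^sub>\<infinity>i\<in>S. x i / 2 ^ i) | x. \<forall>i\<in>S. x i \<in> {0, 1}}"

definition scaled_digit_union :: "(nat \<Rightarrow> nat set) \<Rightarrow> real set" where
  "scaled_digit_union S =
    {0} \<union> (\<Union>i\<in>{1..}. (*) (1 / 2 ^ i) ` (+) 1 ` binary_digit_set (S i))"

end

theory Submission
  imports Defs "HOL-Probability.Infinite_Product_Measure"
begin

text \<open>
  For a digit set \<open>S\<close> write \<open>d n = card (S \<inter> {..n}) / n\<close>. The set \<open>A\<^sub>S\<close> consists of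
  \<open>2 ^ (n * d n)\<close> pieces of size \<open>1 / 2 ^ n\<close>, and at each scale these pieces carry equal mass.
  Hence its restricted dimension for \<open>D\<close> is the lower limit of \<open>d n\<close> over the scales \<open>n\<close> at
  which \<open>D\<close> has an element of size about \<open>1 / 2 ^ n\<close>, and a suitable \<open>D\<close> raises this to the
  upper density of \<open>S\<close>. Restricted dimension is countably stable, so
  the task is to find sets \<open>S\<^sub>i\<close> whose upper densities have supremum \<open>1\<close>, such that no
  single unbounded set of scales sees the densities of the \<open>S\<^sub>i\<close> approach \<open>1\<close>.

  Disjointness achieves this: at each scale the densities of disjoint sets add up to at most
  \<open>1\<close>, so at most one of them exceeds \<open>1/2\<close>. Given \<open>D\<close>, either every \<open>S\<^sub>i\<close> has density
  at most \<open>1/2\<close> at infinitely many of its scales, or one fixed \<open>S\<^sub>i\<close> has density more than \<open>1/2\<close>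
  at all but finitely many of them, and then all the others have density at most \<open>1/2\<close> there. As \<open>S\<^sub>i\<close>
  avoids the multiples of \<open>i + 1\<close>, even this exceptional set has upper density below \<open>1\<close>. So one
  \<open>t < 1\<close> works for all \<open>i\<close> (\<open>block_sets_uniformly_sparse\<close>), which bounds the dimension of the union for \<open>D\<close>
  away from \<open>1\<close> (\<open>content_eq_zero_if_sparse\<close>, \<open>content_UN_eq_zero\<close>). In the other direction,
  \<open>S\<^sub>i\<close> takes all non-multiples of \<open>i + 1\<close> from infinitely many of the blocks
  \<open>{fact k<..fact (k + 1)}\<close>. Each block dwarfs what precedes it, so at its end the density of \<open>S\<^sub>i\<close>
  is close to \<open>1 - 1 / (i + 1)\<close> (\<open>card_block_set_ge\<close>). Using only these scales, a mass distribution
  argument (\<open>mass_distribution_principle\<close>) gives a dimension of at least \<open>1 - 2 / (i + 1)\<close>, so the universal dimension is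
  at least \<open>1\<close>.
\<close>

section \<open>Sets of vanishing restricted content\<close>

lemma admissible_small_element:
  assumes "D \<in> admissible_diameters" "0 < e"
  obtains r where "r \<in> D" "0 < r" "r < e"
proof -
  have "D \<noteq> {}" "Inf D < e" "D \<subseteq> {0<..}"
    using assms unfolding admissible_diameters_def by auto
  then show ?thesis using cInf_lessD[of D e] that by blast
qed

lemma restricted_hausdorff_content_le:
  assumes "E \<subseteq> (\<Union>i. C i)" "\<And>i. bounded (C i) \<and> diameter (C i) \<in> D"
  shows "restricted_hausdorff_content D s E \<le> (\<Sum>i. ennreal (diameter (C i) powr s))"
  unfolding restricted_hausdorff_content_def by (rule Inf_lower) (use assms in blast)

text \<open>Every set in an admissible cover must have its diameter in \<open>D\<close>, so a finite cover cannot be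
  padded by empty sets. Instead it is padded by intervals whose lengths lie in \<open>D\<close> and decrease so fast
  that their total cost is negligible. It thus suffices to find cheap finite covers by intervals of one
  common length.\<close>

lemma content_eq_zeroI:
  assumes D: "D \<in> admissible_diameters" and "0 < s"
    and cover: "\<And>e. 0 < e \<Longrightarrow> \<exists>U r. finite U \<and> r \<in> D \<and> E \<subseteq> (\<Union>u\<in>U. {u..u + r})
      \<and> real (card U) * r powr s < e"
  shows "restricted_hausdorff_content D s (E :: real set) = 0"
proof -
  have "restricted_hausdorff_content D s E \<le> 0 + ennreal e" if "0 < e" for e
  proof -
    from that have "0 < e / 2" by simp
    from cover[OF this] obtain U r where U: "finite U" "r \<in> D" "E \<subseteq> (\<Union>u\<in>U. {u..u + r})"
        "real (card U) * r powr s < e / 2"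
      by blast
    obtain h where h: "bij_betw h {0..<card U} U"
      using ex_bij_betw_nat_finite[OF U(1)] by blast
    \<comment> \<open>The \<open>k\<close>-th padding interval costs at most \<open>e / 2 ^ (k + 2)\<close>, all of them together at most \<open>e / 2\<close>.\<close>
    have "\<exists>d. d \<in> D \<and> 0 < d \<and> d powr s \<le> e / 2 * (1 / 2) ^ Suc k" for k
    proof -
      let ?b = "e / 2 * (1 / 2) ^ Suc k"
      have "0 < ?b powr (1 / s)" using that by simp
      with D obtain d where d: "d \<in> D" "0 < d" "d < ?b powr (1 / s)"
        by (rule admissible_small_element)
      then have "d powr s \<le> (?b powr (1 / s)) powr s"
        using \<open>0 < s\<close> by (intro powr_mono2) auto
      also have "\<dots> = ?b" using \<open>0 < s\<close> that by (simp add: powr_powr)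
      finally show ?thesis using d by blast
    qed
    then obtain d where d: "\<And>k. d k \<in> D" "\<And>k. 0 < d k"
        "\<And>k. d k powr s \<le> e / 2 * (1 / 2) ^ Suc k"
      by metis
    define C where "C k = (if k \<in> {0..<card U} then {h k..h k + r} else {0..d k})" for k
    have "0 < r" using U(2) D unfolding admissible_diameters_def by auto
    let ?f = "\<lambda>k. (if k \<in> {0..<card U} then r powr s else 0) + e / 2 * (1 / 2) ^ Suc k"
    have "?f sums ((\<Sum>k\<in>{0..<card U}. r powr s) + e / 2 * 1)"
      by (intro sums_add sums_If_finite_set sums_mult power_half_series) simp
    then have sums: "?f sums (real (card U) * r powr s + e / 2)" by simp
    have "E \<subseteq> (\<Union>k. C k)"
    proof
      fix v assume "v \<in> E"
      then obtain u where u: "u \<in> U" "v \<in> {u..u + r}" using U(3) by blast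
      have "u \<in> h ` {0..<card U}" using u(1) bij_betw_imp_surj_on[OF h] by simp
      then obtain k where "k \<in> {0..<card U}" "u = h k" by (rule imageE)
      then have "v \<in> C k" using u(2) by (simp add: C_def)
      then show "v \<in> (\<Union>k. C k)" by (rule UN_I[OF UNIV_I])
    qed
    moreover have "bounded (C k) \<and> diameter (C k) \<in> D" for k
      using d(1)[of k] d(2)[of k] U(2) \<open>0 < r\<close> by (simp add: C_def)
    ultimately have "restricted_hausdorff_content D s E \<le> (\<Sum>k. ennreal (diameter (C k) powr s))"
      by (rule restricted_hausdorff_content_le)
    also have "\<dots> \<le> (\<Sum>k. ennreal (?f k))"
    proof (intro suminf_le ennreal_leI)
      show "diameter (C k) powr s \<le> ?f k" for k
      proof (cases "k \<in> {0..<card U}")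
        case True
        then show ?thesis using \<open>0 < r\<close> that by (simp add: C_def)
      next
        case False
        then show ?thesis using d(2,3)[of k] by (simp add: C_def)
      qed
    qed auto
    also have "\<dots> = ennreal (real (card U) * r powr s + e / 2)"
      using that by (intro suminf_ennreal_eq sums) auto
    also have "\<dots> \<le> ennreal e" using U(4) by (intro ennreal_leI) simp
    finally show ?thesis by simp
  qed
  then have "restricted_hausdorff_content D s E \<le> 0"
    by (rule ennreal_le_epsilon)
  then show ?thesis by simp
qed

lemma content_singleton_eq_zero:
  fixes v :: real
  assumes D: "D \<in> admissible_diameters" and "0 < s"
  shows "restricted_hausdorff_content D s {v} = 0"
proof (rule content_eq_zeroI[OF assms])
  fix e :: real assume "0 < e"
  then obtain r where r: "r \<in> D" "0 < r" "r < e powr (1 / s)"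
    using admissible_small_element[OF D, of "e powr (1 / s)"] by auto
  then have "r powr s < (e powr (1 / s)) powr s"
    using \<open>0 < s\<close> by (intro powr_less_mono2) auto
  also have "\<dots> = e" using \<open>0 < s\<close> \<open>0 < e\<close> by (simp add: powr_powr)
  finally show "\<exists>U r. finite U \<and> r \<in> D \<and> {v} \<subseteq> (\<Union>u\<in>U. {u..u + r}) \<and> real (card U) * r powr s < e"
    using r by (intro exI[of _ "{v}"] exI[of _ r]) simp
qed

text \<open>As for Hausdorff measure: a double sequence of covers of cost below \<open>e / 2 ^ (m + 1)\<close> is
  enumerated as a single one.\<close>

lemma content_UN_eq_zero:
  fixes E :: "nat \<Rightarrow> 'a::euclidean_space set"
  assumes "\<And>m. restricted_hausdorff_content D s (E m) = 0"
  shows "restricted_hausdorff_content D s (\<Union>m. E m) = 0"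
proof -
  have "restricted_hausdorff_content D s (\<Union>m. E m) \<le> 0 + ennreal e" if "0 < e" for e
  proof -
    have "\<exists>C. E m \<subseteq> (\<Union>i. C i) \<and> (\<forall>i. bounded (C i) \<and> diameter (C i) \<in> D)
        \<and> (\<Sum>i. ennreal (diameter (C i) powr s)) < ennreal (e * (1 / 2) ^ Suc m)" for m
    proof -
      have "restricted_hausdorff_content D s (E m) < ennreal (e * (1 / 2) ^ Suc m)"
        using assms that by simp
      then show ?thesis
        unfolding restricted_hausdorff_content_def Inf_less_iff by blast
    qed
    then obtain C where C: "\<And>m. E m \<subseteq> (\<Union>i. C m i)"
        "\<And>m i. bounded (C m i) \<and> diameter (C m i) \<in> D"
        "\<And>m. (\<Sum>i. ennreal (diameter (C m i) powr s)) < ennreal (e * (1 / 2) ^ Suc m)"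
      by metis
    let ?C = "\<lambda>p. C (fst p) (snd p)"
    have "(\<Union>m. E m) \<subseteq> (\<Union>i. ?C (prod_decode i))"
    proof
      fix v assume "v \<in> (\<Union>m. E m)"
      then obtain m i where "v \<in> C m i" using C(1) by blast
      then show "v \<in> (\<Union>i. ?C (prod_decode i))"
        by (auto intro!: exI[of _ "prod_encode (m, i)"])
    qed
    then have "restricted_hausdorff_content D s (\<Union>m. E m)
        \<le> (\<Sum>i. ennreal (diameter (?C (prod_decode i)) powr s))"
      using C(2) by (intro restricted_hausdorff_content_le)
    also have "\<dots> = (\<Sum>m. \<Sum>i. ennreal (diameter (C m i) powr s))"
      by (rule suminf_ennreal_2dimen) simp
    also have "\<dots> \<le> (\<Sum>m. ennreal (e * (1 / 2) ^ Suc m))"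
      using C(3) by (intro suminf_le less_imp_le) auto
    also have "\<dots> = ennreal (e * 1)"
      using that by (intro suminf_ennreal_eq sums_mult power_half_series) auto
    finally show ?thesis by simp
  qed
  then have "restricted_hausdorff_content D s (\<Union>m. E m) \<le> 0"
    by (rule ennreal_le_epsilon)
  then show ?thesis by simp
qed

section \<open>Binary digits and their truncation\<close>

text \<open>The point of the digit set that belongs to a digit sequence. Positions outside \<open>S\<close>
  are ignored, so that the same sequence space \<open>nat \<Rightarrow> bool\<close> parametrizes all digit sets.\<close>

definition digit_value :: "nat set \<Rightarrow> (nat \<Rightarrow> bool) \<Rightarrow> real" where
  "digit_value S x = (\<Sum>i. of_bool (i \<in> S \<and> x i) / 2 ^ i)"

definition digit_prefix :: "nat set \<Rightarrow> nat \<Rightarrow> (nat \<Rightarrow> bool) \<Rightarrow> real" where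
  "digit_prefix S n x = (\<Sum>i\<le>n. of_bool (i \<in> S \<and> x i) / 2 ^ i)"

lemma summable_digits: "summable (\<lambda>i. of_bool (P i) / 2 ^ i :: real)"
proof (rule summable_comparison_test)
  show "summable (\<lambda>i. (1 / 2) ^ i :: real)"
    by (rule summable_geometric) simp
  show "\<exists>N. \<forall>i\<ge>N. norm (of_bool (P i) / 2 ^ i :: real) \<le> (1 / 2) ^ i"
    by (auto simp: power_divide)
qed

lemma binary_digit_set_eq_range: "binary_digit_set S = range (digit_value S)"
proof -
  have infsum_eq: "(\<Sum>\<^sub>\<infinity>i\<in>S. y i / 2 ^ i) = digit_value S x"
    if "\<And>i. i \<in> S \<Longrightarrow> y i = of_bool (x i)" for x and y :: "nat \<Rightarrow> real"
  proof -
    have "(\<Sum>\<^sub>\<infinity>i\<in>S. y i / 2 ^ i) = (\<Sum>\<^sub>\<infinity>i. of_bool (i \<in> S \<and> x i) / 2 ^ i)"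
      by (rule infsum_cong_neutral) (use that in auto)
    also have "\<dots> = digit_value S x"
      unfolding digit_value_def
      by (intro infsumI sums_nonneg_imp_has_sum summable_sums summable_digits) auto
    finally show ?thesis .
  qed
  show ?thesis
  proof (intro set_eqI iffI)
    fix v assume "v \<in> binary_digit_set S"
    then obtain y where y: "v = (\<Sum>\<^sub>\<infinity>i\<in>S. y i / 2 ^ i)" "\<forall>i\<in>S. y i \<in> {0, 1}"
      unfolding binary_digit_set_def by blast
    have "v = digit_value S (\<lambda>i. y i = 1)"
      unfolding y(1) by (rule infsum_eq) (use y(2) in auto)
    then show "v \<in> range (digit_value S)" by blast
  next
    fix v assume "v \<in> range (digit_value S)"
    then obtain x where "v = digit_value S x" by blast
    then have "v = (\<Sum>\<^sub>\<infinity>i\<in>S. of_bool (x i) / 2 ^ i)"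
      by (simp add: infsum_eq)
    then show "v \<in> binary_digit_set S"
      unfolding binary_digit_set_def by (auto intro!: exI[of _ "\<lambda>i. of_bool (x i)"])
  qed
qed

lemma scaled_digit_union_eq:
  "scaled_digit_union S = {0} \<union> (\<Union>i\<in>{1..}. range (\<lambda>x. (1 + digit_value (S i) x) / 2 ^ i))"
  unfolding scaled_digit_union_def binary_digit_set_eq_range by (auto simp: image_image)

lemma digit_prefix_le_digit_value: "digit_prefix S n x \<le> digit_value S x"
  unfolding digit_prefix_def digit_value_def
  by (rule sum_le_suminf) (auto intro: summable_digits)

lemma digit_value_le_digit_prefix: "digit_value S x \<le> digit_prefix S n x + 1 / 2 ^ n"
proof -
  let ?f = "\<lambda>i. of_bool (i \<in> S \<and> x i) / 2 ^ i :: real"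
  have geo: "(\<lambda>i. (1 / 2) ^ Suc n * (1 / 2) ^ i :: real) sums ((1 / 2) ^ Suc n * 2)"
    using geometric_sums[of "1 / 2 :: real"] by (intro sums_mult) simp
  have "digit_value S x = (\<Sum>i. ?f (i + Suc n)) + digit_prefix S n x"
    unfolding digit_value_def digit_prefix_def lessThan_Suc_atMost[symmetric]
    by (rule suminf_split_initial_segment[OF summable_digits])
  moreover have "(\<Sum>i. ?f (i + Suc n)) \<le> (\<Sum>i. (1 / 2) ^ Suc n * (1 / 2) ^ i)"
  proof (rule suminf_le)
    show "?f (i + Suc n) \<le> (1 / 2) ^ Suc n * (1 / 2) ^ i" for i
      by (auto simp: power_add power_divide mult_ac)
    show "summable (\<lambda>i. ?f (i + Suc n))"
      by (rule summable_ignore_initial_segment[OF summable_digits])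
    show "summable (\<lambda>i. (1 / 2) ^ Suc n * (1 / 2) ^ i :: real)"
      using geo by (rule sums_summable)
  qed
  moreover have "(\<Sum>i. (1 / 2) ^ Suc n * (1 / 2) ^ i :: real) = 1 / 2 ^ n"
    by (subst sums_unique[OF geo, symmetric]) (simp add: power_divide)
  ultimately show ?thesis by simp
qed

text \<open>Multiplied by \<open>2 ^ n\<close>, a truncation to the first \<open>n\<close> places becomes a natural number whose binary
  expansion consists of the chosen digits. This gives both injectivity of truncation in
  the digits and the spacing \<open>1 / 2 ^ n\<close> of its values.\<close>

lemma digit_prefix_eq_set_encode:
  "2 ^ n * digit_prefix S n x = real (set_encode ((\<lambda>i. n - i) ` {i \<in> S \<inter> {..n}. x i}))"
proof -
  have inj: "inj_on (\<lambda>i. n - i) {i \<in> S \<inter> {..n}. x i}"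
    by (auto simp: inj_on_def)
  have "2 ^ n * digit_prefix S n x = (\<Sum>i\<le>n. of_bool (i \<in> S \<and> x i) * 2 ^ (n - i))"
    unfolding digit_prefix_def sum_distrib_left
    by (intro sum.cong) (auto simp: power_diff)
  also have "\<dots> = (\<Sum>i\<in>{i \<in> S \<inter> {..n}. x i}. 2 ^ (n - i))"
    by (rule sum.mono_neutral_cong_right) auto
  also have "\<dots> = real (set_encode ((\<lambda>i. n - i) ` {i \<in> S \<inter> {..n}. x i}))"
    unfolding set_encode_def sum.reindex[OF inj] by simp
  finally show ?thesis .
qed

lemma digit_prefix_eq_iff:
  "digit_prefix S n y = digit_prefix S n x \<longleftrightarrow> (\<forall>i\<in>S \<inter> {..n}. y i = x i)"
proof
  assume "digit_prefix S n y = digit_prefix S n x"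
  then have "real (set_encode ((\<lambda>i. n - i) ` {i \<in> S \<inter> {..n}. y i}))
      = real (set_encode ((\<lambda>i. n - i) ` {i \<in> S \<inter> {..n}. x i}))"
    unfolding digit_prefix_eq_set_encode[symmetric] by simp
  then have "(\<lambda>i. n - i) ` {i \<in> S \<inter> {..n}. y i} = (\<lambda>i. n - i) ` {i \<in> S \<inter> {..n}. x i}"
    by (simp add: set_encode_eq)
  moreover have "inj_on (\<lambda>i. n - i) {..n}"
    by (auto simp: inj_on_def)
  ultimately have "{i \<in> S \<inter> {..n}. y i} = {i \<in> S \<inter> {..n}. x i}"
    by (subst (asm) inj_on_image_eq_iff) auto
  then show "\<forall>i\<in>S \<inter> {..n}. y i = x i" by blast
next
  assume "\<forall>i\<in>S \<inter> {..n}. y i = x i"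
  then show "digit_prefix S n y = digit_prefix S n x"
    unfolding digit_prefix_def by (intro sum.cong) auto
qed

lemma digit_value_le_1:
  assumes "S \<subseteq> {1..}"
  shows "digit_value S x \<le> 1"
proof -
  have "digit_prefix S 0 x = 0" using assms by (auto simp: digit_prefix_def)
  then show ?thesis using digit_value_le_digit_prefix[of S x 0] by simp
qed

section \<open>Compactness of scaled unions of digit sets\<close>

text \<open>The digit value is a uniform limit of functions of finitely many coordinates, hence
  continuous on the Cantor space \<open>nat \<Rightarrow> bool\<close>.\<close>

lemma compact_range_digit_value: "compact (range (digit_value S))"
proof -
  have "compactin (product_topology (\<lambda>_::nat. euclidean :: bool topology) UNIV) (PiE UNIV (\<lambda>_. UNIV))"
    unfolding compactin_PiE by (simp add: finite_imp_compact)
  then have cantor: "compact (UNIV :: (nat \<Rightarrow> bool) set)"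
    by (simp add: euclidean_product_topology)
  have "uniform_limit UNIV (\<lambda>n x. \<Sum>i<n. of_bool (i \<in> S \<and> x i) / 2 ^ i) (digit_value S) sequentially"
    unfolding digit_value_def
  proof (rule Weierstrass_m_test)
    show "summable (\<lambda>i. (1 / 2) ^ i :: real)" by (rule summable_geometric) simp
  qed (simp add: power_divide)
  moreover have "continuous_on UNIV (\<lambda>x :: nat \<Rightarrow> bool. of_bool (i \<in> S \<and> x i) / 2 ^ i :: real)" for i
  proof -
    have "continuous_on UNIV (\<lambda>b. of_bool (i \<in> S \<and> b) / 2 ^ i :: real)" by simp
    then show ?thesis
      by (rule continuous_on_compose2[OF _ continuous_on_product_coordinates[where i = i]]) simp
  qed
  ultimately have "continuous_on UNIV (digit_value S)"
    by (intro uniform_limit_theorem[where F = sequentially]) (auto intro!: always_eventually continuous_on_sum)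
  then show ?thesis using cantor by (rule compact_continuous_image)
qed

text \<open>The \<open>i\<close>-th piece lies between \<open>1 / 2 ^ i\<close> and \<open>2 / 2 ^ i\<close>, so any open set around \<open>0\<close> contains
  all but finitely many of the pieces, and the exceptions are compact.\<close>

lemma compact_scaled_digit_union:
  assumes "\<And>i. 1 \<le> i \<Longrightarrow> S i \<subseteq> {1..}"
  shows "compact (scaled_digit_union S)"
  unfolding compact_eq_Heine_Borel
proof (intro allI impI, elim conjE)
  fix \<C> assume op: "\<forall>T\<in>\<C>. open T" and cover: "scaled_digit_union S \<subseteq> \<Union>\<C>"
  let ?P = "\<lambda>i. range (\<lambda>x. (1 + digit_value (S i) x) / 2 ^ i)"
  obtain T where T: "T \<in> \<C>" "0 \<in> T"
    using cover unfolding scaled_digit_union_eq by auto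
  then obtain e where e: "0 < e" "ball 0 e \<subseteq> T"
    using op open_contains_ball by blast
  obtain m where m: "(1 / 2) ^ m < e / 2"
    using real_arch_pow_inv[of "e / 2" "1 / 2"] e(1) by auto
  have far: "?P i \<subseteq> T" if "m \<le> i" "1 \<le> i" for i
  proof -
    have "(1 + digit_value (S i) x) / 2 ^ i \<in> ball 0 e" for x
    proof -
      have "0 \<le> digit_value (S i) x"
        unfolding digit_value_def by (intro suminf_nonneg summable_digits) auto
      moreover have "digit_value (S i) x \<le> 1"
        using assms[OF that(2)] by (rule digit_value_le_1)
      moreover have "(1 + digit_value (S i) x) / 2 ^ i \<le> 2 / 2 ^ m"
        using that(1) \<open>digit_value (S i) x \<le> 1\<close> by (intro frac_le power_increasing) auto
      moreover have "2 / 2 ^ m < e"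
        using m by (simp add: power_divide)
      ultimately show ?thesis by simp
    qed
    then show ?thesis using e(2) by blast
  qed
  have "compact (\<Union>i\<in>{1..<m}. ?P i)"
  proof (intro compact_UN finite_atLeastLessThan)
    fix i
    have "compact ((\<lambda>v. (1 + v) / 2 ^ i) ` range (digit_value (S i)))"
      by (intro compact_continuous_image compact_range_digit_value continuous_intros) auto
    then show "compact (?P i)" by (simp add: image_image)
  qed
  moreover have "(\<Union>i\<in>{1..<m}. ?P i) \<subseteq> \<Union>\<C>"
    using cover unfolding scaled_digit_union_eq by (rule order_trans[rotated]) auto
  ultimately obtain \<C>' where C': "\<C>' \<subseteq> \<C>" "finite \<C>'" "(\<Union>i\<in>{1..<m}. ?P i) \<subseteq> \<Union>\<C>'"
    using op by (elim compactE) blast+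
  have "scaled_digit_union S \<subseteq> \<Union>(insert T \<C>')"
  proof
    fix v assume "v \<in> scaled_digit_union S"
    then consider "v = 0" | i where "1 \<le> i" "v \<in> ?P i"
      unfolding scaled_digit_union_eq by auto
    then show "v \<in> \<Union>(insert T \<C>')"
    proof cases
      case 1
      then show ?thesis using T by simp
    next
      case 2
      show ?thesis
      proof (cases "m \<le> i")
        case True
        then show ?thesis using far[OF True 2(1)] 2(2) by blast
      next
        case False
        then have "i \<in> {1..<m}" using 2(1) by simp
        then show ?thesis using C'(3) 2(2) by blast
      qed
    qed
  qed
  then show "\<exists>\<C>'\<subseteq>\<C>. finite \<C>' \<and> scaled_digit_union S \<subseteq> \<Union>\<C>'"
    using C' T(1) by (intro exI[of _ "insert T \<C>'"]) auto
qed

section \<open>Sparse digit sets have small restricted dimension\<close>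

text \<open>Fixing the digits up to place \<open>n\<close> leaves a tail between \<open>0\<close> and \<open>1 / 2 ^ n\<close>.\<close>

lemma digit_value_cover:
  obtains U where "finite U" "card U \<le> 2 ^ card (S \<inter> {..n})"
    "range (digit_value S) \<subseteq> (\<Union>u\<in>U. {u..u + 1 / 2 ^ n})"
proof (rule that)
  let ?U = "(\<lambda>B. \<Sum>i\<in>B. 1 / 2 ^ i :: real) ` Pow (S \<inter> {..n})"
  show "finite ?U" by simp
  show "card ?U \<le> 2 ^ card (S \<inter> {..n})"
    using card_image_le[of "Pow (S \<inter> {..n})"] card_Pow[of "S \<inter> {..n}"] by fastforce
  show "range (digit_value S) \<subseteq> (\<Union>u\<in>?U. {u..u + 1 / 2 ^ n})"
  proof (intro image_subsetI UN_I)
    fix x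
    have "digit_prefix S n x = (\<Sum>i\<in>{i \<in> S \<inter> {..n}. x i}. 1 / 2 ^ i)"
      unfolding digit_prefix_def by (rule sum.mono_neutral_cong_right) auto
    then show "digit_prefix S n x \<in> ?U" by blast
    show "digit_value S x \<in> {digit_prefix S n x..digit_prefix S n x + 1 / 2 ^ n}"
      using digit_prefix_le_digit_value digit_value_le_digit_prefix by auto
  qed
qed

lemma dyadic_scale:
  fixes r :: real
  assumes "0 < r" "r < 1"
  obtains n where "1 / 2 ^ n \<le> r" "r < 2 / 2 ^ n"
proof -
  obtain k where "(1 / 2) ^ k < r"
    using real_arch_pow_inv[of r "1 / 2"] assms(1) by auto
  then have ex: "1 / 2 ^ k \<le> r" by (simp add: power_divide)
  define n where "n = (LEAST n. 1 / 2 ^ n \<le> r)"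
  have n: "1 / 2 ^ n \<le> r" unfolding n_def using ex by (rule LeastI)
  then have "n \<noteq> 0" using assms(2) by (intro notI) simp
  then obtain l where l: "n = Suc l" using not0_implies_Suc by blast
  then have "\<not> 1 / 2 ^ l \<le> r"
    using not_less_Least[of l "\<lambda>n. 1 / 2 ^ n \<le> r"] unfolding n_def[symmetric] by simp
  then have "r < 2 / 2 ^ n" using l by simp
  with n show ?thesis by (rule that)
qed

lemma infinite_dyadic_scales:
  assumes "D \<in> admissible_diameters"
  shows "infinite {n. \<exists>r\<in>D. 1 / 2 ^ n \<le> r \<and> r < 2 / 2 ^ n}"
  unfolding infinite_nat_iff_unbounded
proof
  fix m :: nat
  obtain r where r: "r \<in> D" "0 < r" "r < 1 / 2 ^ m"
    by (rule admissible_small_element[OF assms, of "1 / 2 ^ m"]) auto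
  have "1 / 2 ^ m \<le> (1 :: real)" by (simp add: divide_le_eq_1)
  with r have "r < 1" by linarith
  with r(2) obtain n where n: "1 / 2 ^ n \<le> r" "r < 2 / 2 ^ n"
    by (rule dyadic_scale)
  have "1 / 2 ^ n < (1 / 2 ^ m :: real)" using n r by linarith
  then have "m < n" by (simp add: divide_less_eq less_divide_eq)
  then show "\<exists>n>m. n \<in> {n. \<exists>r\<in>D. 1 / 2 ^ n \<le> r \<and> r < 2 / 2 ^ n}"
    using n r(1) by blast
qed

text \<open>At a sparse scale \<open>n\<close>, at most \<open>2 powr (t * n)\<close> intervals of a common length
  \<open>r < 2 / 2 ^ n\<close> in \<open>D\<close> suffice, at a total cost of at most \<open>2 powr s * 2 powr ((t - s) * n)\<close>.
  As \<open>t < s\<close>, this tends to \<open>0\<close> along infinitely many such scales. Scaling by \<open>1 / 2 ^ i\<close> only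
  shrinks the pieces.\<close>

lemma content_eq_zero_if_sparse:
  assumes D: "D \<in> admissible_diameters" and "0 < s" "t < s"
    and sparse: "infinite {n \<in> {n. \<exists>r\<in>D. 1 / 2 ^ n \<le> r \<and> r < 2 / 2 ^ n}.
      real (card (S \<inter> {..n})) \<le> t * real n}"
  shows "restricted_hausdorff_content D s (range (\<lambda>x. (1 + digit_value S x) / 2 ^ i)) = 0"
proof (rule content_eq_zeroI[OF D \<open>0 < s\<close>])
  fix e :: real assume "0 < e"
  let ?a = "2 powr (t - s)"
  have "?a < 2 powr 0" using \<open>t < s\<close> by (intro powr_less_mono) auto
  then have "?a < 1" by simp
  moreover have "0 < e / 2 powr s" using \<open>0 < e\<close> by simp
  ultimately obtain m where m: "?a ^ m < e / 2 powr s"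
    using real_arch_pow_inv by blast
  obtain n r where n: "m < n" "real (card (S \<inter> {..n})) \<le> t * real n"
      and r: "r \<in> D" "1 / 2 ^ n \<le> r" "r < 2 / 2 ^ n"
    using sparse unfolding infinite_nat_iff_unbounded by blast
  obtain U where U: "finite U" "card U \<le> 2 ^ card (S \<inter> {..n})"
      "range (digit_value S) \<subseteq> (\<Union>u\<in>U. {u..u + 1 / 2 ^ n})"
    by (rule digit_value_cover)
  let ?V = "(\<lambda>u. (1 + u) / 2 ^ i) ` U"
  have "0 < r" using D r(1) unfolding admissible_diameters_def by auto
  have "range (\<lambda>x. (1 + digit_value S x) / 2 ^ i) \<subseteq> (\<Union>v\<in>?V. {v..v + r})"
  proof (rule image_subsetI)
    fix x
    have "digit_value S x \<in> (\<Union>u\<in>U. {u..u + 1 / 2 ^ n})" using U(3) by (rule subsetD) simp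
    then obtain u where u: "u \<in> U" "u \<le> digit_value S x" "digit_value S x \<le> u + r"
      using r(2) by fastforce
    have "(1 + digit_value S x) / 2 ^ i \<le> (1 + u) / 2 ^ i + r / 2 ^ i"
      using u(3) by (simp add: divide_right_mono flip: add_divide_distrib)
    also have "r / 2 ^ i \<le> r / 1"
      using \<open>0 < r\<close> by (intro divide_left_mono) auto
    finally have "(1 + digit_value S x) / 2 ^ i \<in> {(1 + u) / 2 ^ i..(1 + u) / 2 ^ i + r}"
      using u(2) by (simp add: divide_right_mono)
    then show "(1 + digit_value S x) / 2 ^ i \<in> (\<Union>v\<in>?V. {v..v + r})"
      using u(1) by blast
  qed
  moreover have "real (card ?V) * r powr s < e"
  proof -
    have "card ?V \<le> 2 ^ card (S \<inter> {..n})"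
      using U(2) card_image_le[OF U(1), of "\<lambda>u. (1 + u) / 2 ^ i"] by linarith
    then have "real (card ?V) \<le> real (2 ^ card (S \<inter> {..n}))"
      by (rule of_nat_mono)
    also have "\<dots> = 2 powr real (card (S \<inter> {..n}))" by (simp add: powr_realpow)
    also have "\<dots> \<le> 2 powr (t * real n)" using n(2) by (intro powr_mono) auto
    finally have V: "real (card ?V) \<le> 2 powr (t * real n)" .
    have "2 / 2 ^ n = 2 powr (1 - real n)"
      by (simp add: powr_diff powr_realpow)
    then have "r \<le> 2 powr (1 - real n)" using r(3) by simp
    then have "r powr s \<le> (2 powr (1 - real n)) powr s"
      using \<open>0 < r\<close> \<open>0 < s\<close> by (intro powr_mono2) auto
    then have "real (card ?V) * r powr s \<le> 2 powr (t * real n) * (2 powr (1 - real n)) powr s"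
      using V by (intro mult_mono) auto
    also have "\<dots> = 2 powr s * ?a powr real n"
      by (simp add: powr_powr algebra_simps flip: powr_add)
    also have "?a powr real n = ?a ^ n" by (simp add: powr_realpow)
    also have "2 powr s * ?a ^ n \<le> 2 powr s * ?a ^ m"
      using n(1) \<open>?a < 1\<close> by (intro mult_left_mono power_decreasing) auto
    also have "\<dots> < e" using m by (simp add: pos_less_divide_eq mult.commute)
    finally show ?thesis .
  qed
  ultimately show "\<exists>V r. finite V \<and> r \<in> D
      \<and> range (\<lambda>x. (1 + digit_value S x) / 2 ^ i) \<subseteq> (\<Union>v\<in>V. {v..v + r})
      \<and> real (card V) * r powr s < e"
    using U(1) r(1) by (intro exI[of _ ?V] exI[of _ r]) simp
qed

section \<open>Mass distribution by coin flips\<close>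

definition coin_flips :: "(nat \<Rightarrow> bool) measure" where
  "coin_flips = PiM UNIV (\<lambda>_. uniform_count_measure UNIV)"

lemma space_coin_flips [simp]: "space coin_flips = UNIV"
  by (simp add: coin_flips_def space_PiM space_uniform_count_measure)

interpretation coins: product_prob_space "\<lambda>_::nat. uniform_count_measure (UNIV :: bool set)" UNIV
  by (simp add: product_prob_space_def product_prob_space_axioms_def product_sigma_finite_def
      prob_space_uniform_count_measure prob_space_imp_sigma_finite)

lemma
  assumes "finite J"
  shows sets_cylinder: "{x. \<forall>i\<in>J. x i = a i} \<in> sets coin_flips"
    and emeasure_cylinder: "emeasure coin_flips {x. \<forall>i\<in>J. x i = a i} = ennreal (1 / 2 ^ card J)"
proof -
  have eq: "{x. \<forall>i\<in>J. x i = a i} = {x \<in> space coin_flips. \<forall>i\<in>J. x i \<in> {a i}}"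
    by simp
  show "{x. \<forall>i\<in>J. x i = a i} \<in> sets coin_flips"
    unfolding eq coin_flips_def
    by (intro sets.sets_Collect_finite_All assms measurable_sets_Collect[OF measurable_component_singleton])
       (auto simp: sets_uniform_count_measure)
  have "emeasure coin_flips {x. \<forall>i\<in>J. x i = a i}
      = (\<Prod>i\<in>J. emeasure (uniform_count_measure UNIV) {a i})"
    unfolding eq coin_flips_def using assms
    by (intro coins.emeasure_PiM_Collect) (auto simp: sets_uniform_count_measure)
  also have "\<dots> = (\<Prod>i\<in>J. ennreal (1 / 2))"
    by (simp add: emeasure_uniform_count_measure)
  also have "\<dots> = ennreal (1 / 2 ^ card J)"
    by (subst prod_ennreal) (simp_all add: power_divide)
  finally show "emeasure coin_flips {x. \<forall>i\<in>J. x i = a i} = ennreal (1 / 2 ^ card J)" .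
qed

text \<open>Digit sequences whose values lie in a common set of diameter \<open>L / 2 ^ n\<close> have truncations that
  differ by at most \<open>L + 1\<close> steps of size \<open>1 / 2 ^ n\<close>. So at most \<open>2 * L + 3\<close> truncations occur,
  and each is the truncation of exactly the sequences in one cylinder.\<close>

lemma small_set_has_small_mass:
  fixes L n :: nat
  assumes "\<And>u v. u \<in> E \<Longrightarrow> v \<in> E \<Longrightarrow> \<bar>u - v\<bar> \<le> real L / 2 ^ n"
  obtains W where "W \<in> sets coin_flips" "{x. digit_value S x \<in> E} \<subseteq> W"
    "emeasure coin_flips W \<le> ennreal ((2 * real L + 3) / 2 ^ card (S \<inter> {..n}))"
proof (cases "\<exists>x. digit_value S x \<in> E")
  case False
  then show ?thesis by (intro that[of "{}"]) auto
next
  case True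
  then obtain x0 where x0: "digit_value S x0 \<in> E" by blast
  define code where "code x = set_encode ((\<lambda>i. n - i) ` {i \<in> S \<inter> {..n}. x i})" for x
  have code: "digit_prefix S n x = real (code x) / 2 ^ n" for x
    using digit_prefix_eq_set_encode[of n S x] by (simp add: code_def field_simps)
  let ?I = "{code x0 - Suc L..code x0 + Suc L}"
  let ?F = "\<lambda>k. {x. code x = k}"
  have fibre: "?F k \<in> sets coin_flips
      \<and> emeasure coin_flips (?F k) \<le> ennreal (1 / 2 ^ card (S \<inter> {..n}))" for k
  proof (cases "\<exists>x. code x = k")
    case False
    then have "?F k = {}" by auto
    then show ?thesis by simp
  next
    case True
    then obtain x where "code x = k" by blast
    have "?F k = {y. digit_prefix S n y = digit_prefix S n x}"
      using \<open>code x = k\<close> by (auto simp: code)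
    also have "\<dots> = {y. \<forall>i\<in>S \<inter> {..n}. y i = x i}"
      by (simp only: digit_prefix_eq_iff)
    finally show ?thesis
      using sets_cylinder[of "S \<inter> {..n}" x] emeasure_cylinder[of "S \<inter> {..n}" x] by simp
  qed
  show ?thesis
  proof (rule that[of "\<Union>k\<in>?I. ?F k"])
    show "(\<Union>k\<in>?I. ?F k) \<in> sets coin_flips"
      using fibre by (intro sets.finite_UN) auto
    show "{x. digit_value S x \<in> E} \<subseteq> (\<Union>k\<in>?I. ?F k)"
    proof
      fix x assume "x \<in> {x. digit_value S x \<in> E}"
      then have "\<bar>digit_value S x - digit_value S x0\<bar> \<le> real L / 2 ^ n"
        using assms x0 by simp
      moreover have "\<bar>digit_value S x - digit_value S x0 - (digit_prefix S n x - digit_prefix S n x0)\<bar>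
          \<le> 1 / 2 ^ n"
        using digit_prefix_le_digit_value[of S n x] digit_value_le_digit_prefix[of S x n]
          digit_prefix_le_digit_value[of S n x0] digit_value_le_digit_prefix[of S x0 n]
        unfolding abs_le_iff by linarith
      ultimately have "\<bar>real (code x) / 2 ^ n - real (code x0) / 2 ^ n\<bar> \<le> real L / 2 ^ n + 1 / 2 ^ n"
        unfolding code by linarith
      then have "\<bar>real (code x) - real (code x0)\<bar> / 2 ^ n \<le> (real L + 1) / 2 ^ n"
        by (simp add: add_divide_distrib flip: diff_divide_distrib abs_divide)
      then have "\<bar>real (code x) - real (code x0)\<bar> \<le> real L + 1"
        by (simp add: divide_le_cancel)
      then have "code x \<in> ?I" by auto
      then show "x \<in> (\<Union>k\<in>?I. ?F k)" by blast
    qed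
    have "emeasure coin_flips (\<Union>k\<in>?I. ?F k) \<le> (\<Sum>k\<in>?I. emeasure coin_flips (?F k))"
      using fibre by (intro emeasure_subadditive_finite) auto
    also have "\<dots> \<le> (\<Sum>k\<in>?I. ennreal (1 / 2 ^ card (S \<inter> {..n})))"
      using fibre by (intro sum_mono) auto
    also have "\<dots> = ennreal (real (card ?I) * (1 / 2 ^ card (S \<inter> {..n})))"
      by (subst sum_ennreal) auto
    also have "\<dots> \<le> ennreal ((2 * real L + 3) / 2 ^ card (S \<inter> {..n}))"
    proof -
      have "real (card ?I) \<le> 2 * real L + 3" by (simp add: of_nat_diff)
      then show ?thesis by (intro ennreal_leI) (simp add: divide_right_mono)
    qed
    finally show "emeasure coin_flips (\<Union>k\<in>?I. ?F k)
        \<le> ennreal ((2 * real L + 3) / 2 ^ card (S \<inter> {..n}))" .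
  qed
qed

text \<open>If \<open>S\<close> has density at least \<open>s\<close> at the scale of each element of \<open>D\<close>, then a set \<open>C\<close> with diameter in
  \<open>D\<close> has mass at most a constant times \<open>diameter C powr s\<close>. The sets of a cover carry
  total mass at least \<open>1\<close>, which bounds the cost of the cover from below.\<close>

lemma mass_distribution_principle:
  assumes D: "\<And>r. r \<in> D \<Longrightarrow> \<exists>n. 1 / 2 ^ n \<le> r \<and> r < 2 / 2 ^ n \<and> s * real n \<le> real (card (S \<inter> {..n}))"
    and "0 \<le> s"
    and K: "range (\<lambda>x. (1 + digit_value S x) / 2 ^ i) \<subseteq> K"
  shows "restricted_hausdorff_content D s K \<noteq> 0"
proof -
  \<comment> \<open>Under \<open>v \<mapsto> (1 + v) / 2 ^ i\<close>, a set of diameter below \<open>2 / 2 ^ n\<close> has a preimage of diameter below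
    \<open>2 * 2 ^ i / 2 ^ n\<close>, so the preceding lemma applies with \<open>L = 2 * 2 ^ i\<close>.\<close>
  define c :: real where "c = 2 * real (2 * 2 ^ i) + 3"
  have "c > 0" unfolding c_def by (simp add: add_pos_pos)
  have "ennreal (1 / c) \<le> (\<Sum>j. ennreal (diameter (C j) powr s))"
    if C: "K \<subseteq> (\<Union>j. C j)" "\<forall>j. bounded (C j) \<and> diameter (C j) \<in> D" for C :: "nat \<Rightarrow> real set"
  proof -
    have "\<exists>W. W \<in> sets coin_flips \<and> {x. (1 + digit_value S x) / 2 ^ i \<in> C j} \<subseteq> W
        \<and> emeasure coin_flips W \<le> ennreal (c * diameter (C j) powr s)" for j
    proof -
      obtain n where n: "1 / 2 ^ n \<le> diameter (C j)" "diameter (C j) < 2 / 2 ^ n"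
          "s * real n \<le> real (card (S \<inter> {..n}))"
        using D C(2) by blast
      let ?E = "{v. (1 + v) / 2 ^ i \<in> C j}"
      have "\<bar>u - v\<bar> \<le> real (2 * 2 ^ i) / 2 ^ n" if "u \<in> ?E" "v \<in> ?E" for u v
      proof -
        have "dist ((1 + u) / 2 ^ i) ((1 + v) / 2 ^ i) \<le> diameter (C j)"
          using that C(2) by (intro diameter_bounded_bound) auto
        moreover have "dist ((1 + u) / 2 ^ i) ((1 + v) / 2 ^ i) = \<bar>u - v\<bar> / 2 ^ i"
          by (simp add: dist_real_def flip: diff_divide_distrib)
        ultimately have "\<bar>u - v\<bar> / 2 ^ i \<le> 2 / 2 ^ n" using n by linarith
        then have "\<bar>u - v\<bar> \<le> 2 / 2 ^ n * 2 ^ i" by (simp add: pos_divide_le_eq)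
        then show ?thesis by simp
      qed
      from small_set_has_small_mass[OF this, of _ S] obtain W where W: "W \<in> sets coin_flips" "{x. digit_value S x \<in> ?E} \<subseteq> W"
          "emeasure coin_flips W \<le> ennreal ((2 * real (2 * 2 ^ i) + 3) / 2 ^ card (S \<inter> {..n}))"
        by metis
      have "1 / 2 ^ card (S \<inter> {..n}) = 2 powr - real (card (S \<inter> {..n}))"
        by (simp add: powr_minus powr_realpow divide_inverse)
      also have "\<dots> \<le> 2 powr - (s * real n)"
        using n(3) by (intro powr_mono) auto
      also have "\<dots> = (2 powr - real n) powr s"
        by (simp add: powr_powr mult.commute)
      also have "\<dots> = (1 / 2 ^ n) powr s"
        by (simp add: powr_minus powr_realpow divide_inverse)
      also have "\<dots> \<le> diameter (C j) powr s"
        using n(1) \<open>0 \<le> s\<close> by (intro powr_mono2) auto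
      finally have "c * (1 / 2 ^ card (S \<inter> {..n})) \<le> c * diameter (C j) powr s"
        using \<open>c > 0\<close> by (intro mult_left_mono) auto
      then have "emeasure coin_flips W \<le> ennreal (c * diameter (C j) powr s)"
        using W(3) unfolding c_def[symmetric] by (auto intro: order_trans ennreal_leI)
      then show ?thesis using W by auto
    qed
    then obtain W where W: "\<And>j. W j \<in> sets coin_flips"
        "\<And>j. {x. (1 + digit_value S x) / 2 ^ i \<in> C j} \<subseteq> W j"
        "\<And>j. emeasure coin_flips (W j) \<le> ennreal (c * diameter (C j) powr s)"
      by metis
    have "x \<in> (\<Union>j. W j)" for x
    proof -
      have "(1 + digit_value S x) / 2 ^ i \<in> K" using K by (simp add: image_subset_iff)
      then obtain j where "(1 + digit_value S x) / 2 ^ i \<in> C j" using C(1) by auto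
      then have "x \<in> W j" using W(2)[of j] by auto
      then show ?thesis by blast
    qed
    then have "(\<Union>j. W j) = UNIV" by blast
    then have "1 = emeasure coin_flips (\<Union>j. W j)"
      using coins.P.emeasure_space_1 by (simp add: coin_flips_def[symmetric])
    also have "\<dots> \<le> (\<Sum>j. emeasure coin_flips (W j))"
      using W(1) by (intro emeasure_subadditive_countably) auto
    also have "\<dots> \<le> (\<Sum>j. ennreal c * ennreal (diameter (C j) powr s))"
      using W(3) \<open>c > 0\<close> by (intro suminf_le) (auto simp: ennreal_mult)
    also have "\<dots> = ennreal c * (\<Sum>j. ennreal (diameter (C j) powr s))"
      by simp
    finally have "ennreal (1 / c) * 1
        \<le> ennreal (1 / c) * (ennreal c * (\<Sum>j. ennreal (diameter (C j) powr s)))"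
      by (intro mult_left_mono) auto
    also have "\<dots> = (\<Sum>j. ennreal (diameter (C j) powr s))"
      using \<open>c > 0\<close> by (simp add: mult.assoc[symmetric] ennreal_mult'[symmetric])
    finally show ?thesis by simp
  qed
  then have "ennreal (1 / c) \<le> restricted_hausdorff_content D s K"
    unfolding restricted_hausdorff_content_def by (intro Inf_greatest) auto
  moreover have "ennreal (1 / c) > 0" using \<open>c > 0\<close> by simp
  ultimately show ?thesis by auto
qed

section \<open>Disjoint sets that are dense at different scales\<close>

text \<open>The first component of \<open>prod_decode k\<close> takes every value infinitely often, so it assigns
  infinitely many of the blocks \<open>{fact k<..fact (Suc k)}\<close> to each index \<open>i\<close>. Removing the multiples of \<open>Suc i\<close> keeps
  the upper density of each set below \<open>1\<close>.\<close>

definition block_set :: "nat \<Rightarrow> nat set" where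
  "block_set i = {n. \<exists>k. fact k < n \<and> n \<le> fact (Suc k) \<and> fst (prod_decode k) = i
      \<and> \<not> Suc i dvd n}"

lemma block_set_subset: "block_set i \<subseteq> {1..}"
  unfolding block_set_def by (auto simp: Suc_le_eq intro: gr_zeroI)

lemma block_set_disjoint:
  assumes "i \<noteq> j"
  shows "block_set i \<inter> block_set j = {}"
proof -
  have "k = l" if "fact k < n" "n \<le> fact (Suc k)" "fact l < n" "n \<le> fact (Suc l)" for k l n :: nat
  proof (rule ccontr)
    assume "k \<noteq> l"
    then consider "Suc k \<le> l" | "Suc l \<le> k" by linarith
    then show False
      using fact_mono_nat[of "Suc k" l] fact_mono_nat[of "Suc l" k] that by cases linarith+
  qed
  then show ?thesis using assms unfolding block_set_def by blast
qed

lemma card_block_set_add_le: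
  assumes "i \<noteq> j"
  shows "card (block_set i \<inter> {..n}) + card (block_set j \<inter> {..n}) \<le> n"
proof -
  have "card (block_set i \<inter> {..n}) + card (block_set j \<inter> {..n})
      = card (block_set i \<inter> {..n} \<union> block_set j \<inter> {..n})"
    using block_set_disjoint[OF assms] by (intro card_Un_disjoint[symmetric]) auto
  also have "\<dots> \<le> card {1..n}"
    using block_set_subset[of i] block_set_subset[of j] by (intro card_mono) auto
  finally show ?thesis by simp
qed

lemma card_multiples:
  assumes "0 < q"
  shows "card {m \<in> {1..n}. q dvd m} = n div q"
proof -
  have "{m \<in> {1..n}. q dvd m} = (\<lambda>j. q * j) ` {1..n div q}"
    using assms by (auto simp: image_iff less_eq_div_iff_mult_less_eq mult.commute elim!: dvdE
        intro!: bexI)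
  moreover have "inj_on (\<lambda>j. q * j) {1..n div q}"
    using assms by (auto simp: inj_on_def)
  ultimately show ?thesis by (simp add: card_image)
qed

lemma card_block_set_le: "card (block_set i \<inter> {..n}) \<le> n - n div Suc i"
proof -
  have "card (block_set i \<inter> {..n}) \<le> card ({1..n} - {m \<in> {1..n}. Suc i dvd m})"
    using block_set_subset unfolding block_set_def by (intro card_mono) fastforce+
  also have "\<dots> = n - n div Suc i"
    by (subst card_Diff_subset) (auto simp: card_multiples[simplified])
  finally show ?thesis .
qed

text \<open>At the end of its block, the \<open>i\<close>-th set misses at most the part before the block, which is a fraction
  \<open>1 / (k + 1)\<close>, and the multiples of \<open>Suc i\<close>. Each amounts to at most a fraction \<open>1 / (i + 1)\<close>,
  as the pairing function gives \<open>i \<le> k\<close>.\<close>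

lemma card_block_set_ge:
  assumes "fst (prod_decode k) = i"
  shows "(1 - 2 / real (Suc i)) * real (fact (Suc k)) \<le> real (card (block_set i \<inter> {..fact (Suc k)}))"
proof -
  let ?n = "fact (Suc k) :: nat"
  have "i \<le> k"
    using le_prod_encode_1[of i "snd (prod_decode k)"] assms by auto
  have sub: "{1..?n} - {1..fact k} - {m \<in> {1..?n}. Suc i dvd m} \<subseteq> block_set i \<inter> {..?n}"
    using assms unfolding block_set_def by auto
  have "?n - fact k - ?n div Suc i \<le> card ({1..?n} - {1..fact k}) - card {m \<in> {1..?n}. Suc i dvd m}"
    by (simp add: card_multiples[simplified] card_Diff_subset fact_mono_nat del: fact_Suc)
  also have "\<dots> \<le> card ({1..?n} - {1..fact k} - {m \<in> {1..?n}. Suc i dvd m})"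
    by (rule diff_card_le_card_Diff) auto
  also have "\<dots> \<le> card (block_set i \<inter> {..?n})"
    using sub by (intro card_mono) auto
  finally have "real ?n - real (fact k) - real (?n div Suc i) \<le> real (card (block_set i \<inter> {..?n}))"
    by linarith
  moreover have "real (?n div Suc i) \<le> real ?n / real (Suc i)"
    by (rule of_nat_div_le_of_nat)
  moreover have "real (fact k) \<le> real ?n / real (Suc i)"
    using \<open>i \<le> k\<close> by (simp add: field_simps mult_left_mono)
  moreover have "(1 - 2 / real (Suc i)) * real ?n
      = real ?n - real ?n / real (Suc i) - real ?n / real (Suc i)"
    by (simp only: left_diff_distrib mult_1_left times_divide_eq_left mult_2 add_divide_distrib
        diff_diff_eq)
  ultimately show ?thesis by linarith
qed

text \<open>The heart of the construction: since the sets are disjoint, at most one of them has density above \<open>1/2\<close> at any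
  given scale. If some set, the one with index \<open>i0\<close>, has this density at all but finitely many scales of \<open>N\<close>,
  then all others have density at most \<open>1/2\<close> there, and \<open>i0\<close> itself is controlled by the missing multiples of \<open>Suc i0\<close>.\<close>

lemma block_sets_uniformly_sparse:
  assumes N: "infinite N"
  obtains t where "0 \<le> t" "t < 1"
    "\<And>i. infinite {n \<in> N. real (card (block_set i \<inter> {..n})) \<le> t * real n}"
proof (cases "\<forall>i. infinite {n \<in> N. real (card (block_set i \<inter> {..n})) \<le> 1 / 2 * real n}")
  case True
  then show ?thesis by (intro that[of "1 / 2"]) auto
next
  case False
  then obtain i0 where fin: "finite {n \<in> N. real (card (block_set i0 \<inter> {..n})) \<le> 1 / 2 * real n}"
    by blast
  \<comment> \<open>The density \<open>1 - 1 / (i0 + 1)\<close> is exceeded by a rounding error of at most \<open>1\<close> element, which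
    half of the gap \<open>1 / (i0 + 1)\<close> absorbs for \<open>n \<ge> 2 * (i0 + 1)\<close>.\<close>
  define t where "t = 1 - 1 / (2 * real (Suc i0))"
  have t: "1 / 2 \<le> t" "t < 1" by (simp_all add: t_def field_simps)
  have "infinite {n \<in> N. real (card (block_set i \<inter> {..n})) \<le> t * real n}" for i
  proof (cases "i = i0")
    case False
    have "N - {n \<in> N. real (card (block_set i0 \<inter> {..n})) \<le> 1 / 2 * real n}
        \<subseteq> {n \<in> N. real (card (block_set i \<inter> {..n})) \<le> t * real n}"
    proof
      fix n assume n: "n \<in> N - {n \<in> N. real (card (block_set i0 \<inter> {..n})) \<le> 1 / 2 * real n}"
      have "real (card (block_set i \<inter> {..n})) \<le> 1 / 2 * real n"
        using n card_block_set_add_le[OF False, of n] by auto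
      also have "\<dots> \<le> t * real n"
        using t by (intro mult_right_mono) auto
      finally show "n \<in> {n \<in> N. real (card (block_set i \<inter> {..n})) \<le> t * real n}"
        using n by simp
    qed
    then show ?thesis
      using Diff_infinite_finite[OF fin N] infinite_super by blast
  next
    case True
    have "N - {..<2 * Suc i0} \<subseteq> {n \<in> N. real (card (block_set i \<inter> {..n})) \<le> t * real n}"
    proof
      fix n assume n: "n \<in> N - {..<2 * Suc i0}"
      let ?q = "real (Suc i0)"
      have "card (block_set i \<inter> {..n}) + n div Suc i0 \<le> n"
        using card_block_set_le[of i0 n] div_le_dividend[of n "Suc i0"] unfolding True by linarith
      then have "real (card (block_set i \<inter> {..n})) + real (n div Suc i0) \<le> real n"
        by (simp flip: of_nat_add)
      moreover define z where "z = real n / (2 * ?q)"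
      moreover have "2 * z \<le> real (n div Suc i0) + 1"
      proof -
        have "2 * z = real n / ?q" unfolding z_def by (simp del: of_nat_Suc)
        then show ?thesis
          using floor_divide_of_nat_eq[where 'a = real, of n "Suc i0"] by linarith
      qed
      moreover have "1 \<le> z"
      proof -
        have "2 * Suc i0 \<le> n" using n by auto
        then have "2 * ?q \<le> real n" by linarith
        then show ?thesis by (simp add: z_def field_simps)
      qed
      ultimately have "real (card (block_set i \<inter> {..n})) \<le> real n - z" by linarith
      also have "\<dots> = t * real n" by (simp add: t_def z_def left_diff_distrib)
      finally show "n \<in> {n \<in> N. real (card (block_set i \<inter> {..n})) \<le> t * real n}"
        using n by simp
    qed
    then show ?thesis
      using Diff_infinite_finite[OF _ N, of "{..<2 * Suc i0}"] infinite_super by blast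
  qed
  then show ?thesis using t by (intro that[of t]) auto
qed

section \<open>The two dimension bounds for the block union\<close>

text \<open>The uniform \<open>t\<close> leaves room for one exponent \<open>s\<close> between \<open>t\<close> and \<open>1\<close> at which all pieces have
  content zero. Without uniformity in \<open>i\<close> the exponents of the pieces could tend to \<open>1\<close>.\<close>

lemma dim_block_union_less_1:
  assumes D: "D \<in> admissible_diameters"
  shows "restricted_hausdorff_dim D (scaled_digit_union block_set) < 1"
proof -
  obtain t where t: "0 \<le> t" "t < 1"
    and sparse: "\<And>i. infinite {n \<in> {n. \<exists>r\<in>D. 1 / 2 ^ n \<le> r \<and> r < 2 / 2 ^ n}.
      real (card (block_set i \<inter> {..n})) \<le> t * real n}"
    by (rule block_sets_uniformly_sparse[OF infinite_dyadic_scales[OF D]]) (rule that)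
  define s where "s = (1 + t) / 2"
  have s: "0 < s" "t < s" "s < 1" using t by (simp_all add: s_def)
  define E where "E i = (if i = 0 then {0}
      else range (\<lambda>x. (1 + digit_value (block_set i) x) / 2 ^ i))" for i :: nat
  have "restricted_hausdorff_content D s (E i) = 0" for i
    using content_singleton_eq_zero[OF D s(1)] content_eq_zero_if_sparse[OF D s(1,2) sparse]
    by (simp add: E_def)
  then have "restricted_hausdorff_content D s (\<Union>i. E i) = 0"
    by (rule content_UN_eq_zero)
  moreover have "scaled_digit_union block_set = (\<Union>i. E i)"
  proof -
    have "(UNIV :: nat set) = insert 0 {1..}" by auto
    then have "(\<Union>i. E i) = E 0 \<union> (\<Union>i\<in>{1..}. E i)"
      by (metis UN_insert)
    then show ?thesis unfolding scaled_digit_union_eq by (simp add: E_def)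
  qed
  ultimately have "restricted_hausdorff_dim D (scaled_digit_union block_set) \<le> ennreal s"
    unfolding restricted_hausdorff_dim_def using s(1) by (intro Inf_lower) auto
  also have "\<dots> < 1" using s by (simp add: ennreal_less_one_iff)
  finally show ?thesis .
qed

text \<open>Diameters in the dyadic range of the final scale of a block with index \<open>i\<close>. Half-open
  intervals are Sorgenfrey-open.\<close>

definition block_diameters :: "nat \<Rightarrow> real set" where
  "block_diameters i = (\<Union>k\<in>{k. fst (prod_decode k) = i}.
     {1 / 2 ^ fact (Suc k)..<2 / 2 ^ fact (Suc k)})"

lemma block_diameters_admissible: "block_diameters i \<in> admissible_diameters"
proof -
  have pos: "block_diameters i \<subseteq> {0<..}"
  proof
    fix r assume "r \<in> block_diameters i"
    then obtain k where "1 / 2 ^ fact (Suc k) \<le> r" unfolding block_diameters_def by auto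
    then have "0 < r" by (rule less_le_trans[rotated]) simp
    then show "r \<in> {0<..}" by simp
  qed
  have small: "\<exists>r\<in>block_diameters i. r < e" if "0 < e" for e
  proof -
    obtain m where m: "(1 / 2) ^ m < e"
      using real_arch_pow_inv[of e "1 / 2"] \<open>0 < e\<close> by auto
    define k where "k = prod_encode (i, m)"
    have "m \<le> k" unfolding k_def by (rule le_prod_encode_2)
    let ?r = "1 / 2 ^ fact (Suc k) :: real"
    have "?r \<in> block_diameters i"
      unfolding block_diameters_def
      by (intro UN_I[of k]) (auto simp: k_def divide_strict_right_mono simp del: fact_Suc)
    moreover have "?r < e"
    proof -
      have "m \<le> fact (Suc k)" using \<open>m \<le> k\<close> fact_ge_self[of "Suc k"] by linarith
      then have "(1 / 2 :: real) ^ fact (Suc k) \<le> (1 / 2) ^ m"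
        by (intro power_decreasing) auto
      then show ?thesis using m by (simp add: power_divide del: fact_Suc)
    qed
    ultimately show ?thesis by blast
  qed
  then have nonempty: "block_diameters i \<noteq> {}" using zero_less_one by blast
  moreover have "Inf (block_diameters i) = 0"
  proof (rule antisym)
    show "0 \<le> Inf (block_diameters i)"
      using nonempty pos by (intro cInf_greatest) auto
    show "Inf (block_diameters i) \<le> 0"
    proof (rule field_le_epsilon)
      fix e :: real assume "0 < e"
      then obtain r where r: "r \<in> block_diameters i" "r < e" using small by blast
      have "Inf (block_diameters i) \<le> r"
        using r(1) pos by (intro cInf_lower bdd_belowI[of _ 0]) auto
      then show "Inf (block_diameters i) \<le> 0 + e" using r(2) by simp
    qed
  qed
  moreover have "openin sorgenfrey (block_diameters i)"
    unfolding openin_sorgenfrey_iff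
  proof
    fix r assume "r \<in> block_diameters i"
    then obtain k where k: "fst (prod_decode k) = i"
        "1 / 2 ^ fact (Suc k) \<le> r" "r < 2 / 2 ^ fact (Suc k)"
      unfolding block_diameters_def by (auto simp del: fact_Suc)
    then have "{r..<r + (2 / 2 ^ fact (Suc k) - r)} \<subseteq> block_diameters i"
      unfolding block_diameters_def by (intro subsetI UN_I[of k]) (auto simp del: fact_Suc)
    then show "\<exists>\<delta>>0. {r..<r + \<delta>} \<subseteq> block_diameters i"
      using k(3) by (intro exI[of _ "2 / 2 ^ fact (Suc k) - r"]) (simp del: fact_Suc)
  qed
  ultimately show ?thesis using pos by (simp add: admissible_diameters_def)
qed

lemma dim_block_union_ge:
  assumes "1 \<le> i"
  shows "ennreal (1 - 2 / real (Suc i))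
    \<le> restricted_hausdorff_dim (block_diameters i) (scaled_digit_union block_set)"
  unfolding restricted_hausdorff_dim_def
proof (rule Inf_greatest, clarify)
  fix s :: real
  assume s: "0 \<le> s"
    "restricted_hausdorff_content (block_diameters i) s (scaled_digit_union block_set) = 0"
  have "\<not> s \<le> 1 - 2 / real (Suc i)"
  proof
    assume le: "s \<le> 1 - 2 / real (Suc i)"
    have "\<exists>n. 1 / 2 ^ n \<le> r \<and> r < 2 / 2 ^ n \<and> s * real n \<le> real (card (block_set i \<inter> {..n}))"
      if "r \<in> block_diameters i" for r
    proof -
      from that obtain k where k: "fst (prod_decode k) = i"
          "1 / 2 ^ fact (Suc k) \<le> r" "r < 2 / 2 ^ fact (Suc k)"
        unfolding block_diameters_def by (auto simp del: fact_Suc)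
      have "s * real (fact (Suc k)) \<le> (1 - 2 / real (Suc i)) * real (fact (Suc k))"
        using le by (rule mult_right_mono) simp
      also have "\<dots> \<le> real (card (block_set i \<inter> {..fact (Suc k)}))"
        using k(1) by (rule card_block_set_ge)
      finally show ?thesis using k(2,3) by blast
    qed
    moreover have "range (\<lambda>x. (1 + digit_value (block_set i) x) / 2 ^ i)
        \<subseteq> scaled_digit_union block_set"
      unfolding scaled_digit_union_eq using assms by blast
    ultimately have "restricted_hausdorff_content (block_diameters i) s
        (scaled_digit_union block_set) \<noteq> 0"
      using s(1) by (intro mass_distribution_principle)
    then show False using s(2) by contradiction
  qed
  then show "ennreal (1 - 2 / real (Suc i)) \<le> ennreal s"
    by (intro ennreal_leI) linarith
qed

lemma universal_dim_block_union_ge_1: "1 \<le> universal_hausdorff_dim (scaled_digit_union block_set)"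
proof (rule LIMSEQ_le_const2)
  have "(\<lambda>i. 1 - 2 / real (Suc i)) \<longlonglongrightarrow> 1 - 0"
    by (intro tendsto_diff tendsto_const LIMSEQ_Suc lim_const_over_n)
  then have "(\<lambda>i. ennreal (1 - 2 / real (Suc i))) \<longlonglongrightarrow> ennreal (1 - 0)"
    by (rule tendsto_ennrealI)
  then show "(\<lambda>i. ennreal (1 - 2 / real (Suc i))) \<longlonglongrightarrow> 1" by simp
  show "\<exists>N. \<forall>i\<ge>N. ennreal (1 - 2 / real (Suc i))
      \<le> universal_hausdorff_dim (scaled_digit_union block_set)"
  proof (intro exI[of _ 1] allI impI)
    fix i :: nat assume "1 \<le> i"
    then show "ennreal (1 - 2 / real (Suc i))
        \<le> universal_hausdorff_dim (scaled_digit_union block_set)"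
      unfolding universal_hausdorff_dim_def
      by (intro SUP_upper2[OF block_diameters_admissible[of i]] dim_block_union_ge)
  qed
qed

theorem proposition4p7:
  "\<exists>S :: nat \<Rightarrow> nat set.
     (\<forall>i\<ge>1. S i \<subseteq> {1..}) \<and>
     compact (scaled_digit_union S) \<and>
     (\<forall>D\<in>admissible_diameters.
        restricted_hausdorff_dim D (scaled_digit_union S)
          < universal_hausdorff_dim (scaled_digit_union S))"
proof (intro exI[of _ block_set] conjI allI impI ballI)
  show "block_set i \<subseteq> {1..}" for i by (rule block_set_subset)
  show "compact (scaled_digit_union block_set)"
    by (intro compact_scaled_digit_union block_set_subset)
  show "restricted_hausdorff_dim D (scaled_digit_union block_set)
      < universal_hausdorff_dim (scaled_digit_union block_set)"
    if "D \<in> admissible_diameters" for D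
    using dim_block_union_less_1[OF that] universal_dim_block_union_ge_1
    by (rule less_le_trans)
qed

end
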